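(* Let $k,m,n$ be integers such that $m\ge 2k-1$ if $k>0$, $m\ge -2k$ if $k\le 0$, and $n\ge\binom{m+1}{2}$. Then the number of strict partitions of $n$ with exactly $m$ parts and BG-rank equal to $k$ equals (1) the number of $\Delta\in\mathcal{S}_{2k-1,\,m-2k+1}$ with $|\Delta|=n-\binom{2k}{2}$, if $k>0$ and $m>2k-1$; (2) the number of partitions $\lambda$ with largest part no greater than $2k-1$ and $2|\lambda|=n-\binom{2k}{2}$, if $k>0$ and $m=2k-1$; (3) the number of $\Delta\in\mathcal{S}_{-2k,\,m+2k}$ with $|\Delta|=n-\binom{2k}{2}$, if $k\le 0$ and $m>-2k$; (4) the number of partitions $\lambda$ with largest part no greater than $-2k$ and $2|\lambda|=n-\binom{2k}{2}$, if $k\le 0$ and $m=-2k$.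
   Context: A partition $\lambda=(\lambda_1,\lambda_2,\dots,\lambda_r)$ is a finite weakly decreasing sequence of positive integers (its parts), and $|\lambda|$ is the sum of its parts; the empty partition is allowed (with $|\varnothing|=0$, and it counts as having largest part no greater than any nonnegative bound). A strict partition is a partition whose parts are pairwise distinct (the empty partition included). The BG-rank of a partition $\lambda$ is the number of odd parts $\lambda_i$ with $i$ odd minus the number of odd parts $\lambda_i$ with $i$ even. For every integer $k$, $\binom{2k}{2}=k(2k-1)$. For integers $a\ge 0$ and $l\ge b\ge 1$, a finite sequence $\{d_1,\dots,d_l\}$ of $l$ positive integers is called an $(a,b)$-sequence of length $l$ if: (i) $d_1=a+1,\ d_2=a+2,\ \dots,\ d_b=a+b$; (ii) $d_b\ge d_{b+1}\ge\cdots\ge d_l\ge 1$; (iii) $\sum_{i=1}^{l}(-1)^i d_i=0$. $\mathcal{S}_{a,b}$ denotes the set of all $(a,b)$-sequences (of any length), and $|\Delta|=\sum_{i=1}^l d_i$ for $\Delta=\{d_1,\dots,d_l\}$. *)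

theory Defs
  imports Complex_Main
begin

text \<open>
  Partitions and sequences are lists, whose positions count from 0; the \<open>i\<close>-th term in the
  usual 1-based numbering is \<open>xs ! (i - 1)\<close>.
\<close>

definition is_partition :: "nat list \<Rightarrow> bool" where
  "is_partition la \<longleftrightarrow> sorted_wrt (\<ge>) la \<and> (\<forall>p\<in>set la. 0 < p)"

definition is_strict_partition :: "nat list \<Rightarrow> bool" where
  "is_strict_partition la \<longleftrightarrow> is_partition la \<and> distinct la"

text \<open>The value 0 on the empty partition makes it satisfy every nonnegative upper bound.\<close>

definition largest_part :: "nat list \<Rightarrow> nat" where
  "largest_part la = (if la = [] then 0 else Max (set la))"

definition BG_rank :: "nat list \<Rightarrow> int" where
  "BG_rank la =
     int (card {i \<in> {1..length la}. odd i \<and> odd (la ! (i - 1))})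
   - int (card {i \<in> {1..length la}. even i \<and> odd (la ! (i - 1))})"

definition strict_partitions_BG :: "int \<Rightarrow> int \<Rightarrow> int \<Rightarrow> nat list set" where
  "strict_partitions_BG n m k =
     {la. is_strict_partition la \<and> int (sum_list la) = n
        \<and> int (length la) = m \<and> BG_rank la = k}"

definition ab_sequences :: "nat \<Rightarrow> nat \<Rightarrow> nat list set" where
  "ab_sequences a b =
     {ds. 1 \<le> b \<and> b \<le> length ds
        \<and> (\<forall>i\<in>{1..length ds}. 1 \<le> ds ! (i - 1))
        \<and> (\<forall>i\<in>{1..b}. ds ! (i - 1) = a + i)
        \<and> (\<forall>i\<in>{b..<length ds}. ds ! (i - 1) \<ge> ds ! i)
        \<and> (\<Sum>i = 1..length ds. (-1) ^ i * int (ds ! (i - 1))) = 0}"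

text \<open>The binomial coefficient \<open>x\<close> over \<open>2\<close>, for an integer \<open>x\<close> of either sign.\<close>

definition binom2 :: "int \<Rightarrow> int" where
  "binom2 x = (x * (x - 1)) div 2"

lemma binom2_double: "binom2 (2 * k) = k * (2 * k - 1)"
  by (simp add: binom2_def)

lemma binom2_of_nat: "binom2 (int j) = int (j choose 2)"
  by (cases j) (simp_all add: binom2_def choose_two zdiv_int algebra_simps)

text \<open>
  All sets counted by the theorem are finite by the following fact, so that
  \<open>card\<close> is a genuine count.
\<close>

lemma finite_positive_lists_sum:
  "finite {xs :: nat list. (\<forall>x\<in>set xs. 0 < x) \<and> sum_list xs = N}"
proof (rule finite_subset)
  show "{xs :: nat list. (\<forall>x\<in>set xs. 0 < x) \<and> sum_list xs = N}
      \<subseteq> {xs. set xs \<subseteq> {..N} \<and> length xs \<le> N}"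
  proof clarify
    fix xs :: "nat list"
    assume pos: "\<forall>x\<in>set xs. 0 < x"
    have "length xs \<le> sum_list xs" using pos by (induction xs) auto
    moreover have "set xs \<subseteq> {..sum_list xs}" by (auto intro: member_le_sum_list)
    ultimately show "set xs \<subseteq> {..sum_list xs} \<and> length xs \<le> sum_list xs" by simp
  qed
  show "finite {xs :: nat list. set xs \<subseteq> {..N} \<and> length xs \<le> N}"
    by (rule finite_lists_length_le) simp
qed

end

theory Submission
  imports Defs
begin

text \<open>
  Let \<open>\<lambda>\<close> be a strict partition with \<open>m\<close> parts. Every size \<open>1, \<dots>, m\<close> occurs among the columns of
  its Young diagram; taking out one column of each size leaves a partition \<open>\<mu>\<close> with parts at most
  \<open>m\<close>, namely the conjugate of \<open>\<nu> = (\<lambda>\<^sub>1 - m, \<lambda>\<^sub>2 - (m - 1), \<dots>, \<lambda>\<^sub>m - 1)\<close>. The alternating sum of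
  \<open>\<mu>\<close> is the number of odd parts of \<open>\<nu>\<close>. Adding the staircase back flips the parity of every second
  part, those with one fixed sign in the BG-rank; an odd part of \<open>\<nu>\<close> at such a place removes a
  contribution of that sign, while at any other place it adds one of the opposite sign. Hence the
  BG-rank of \<open>\<lambda>\<close> depends only on \<open>m\<close> and the number of odd parts of \<open>\<nu>\<close>, and it turns out to be
  the alternating sum \<open>d\<^sub>1 - d\<^sub>2 + d\<^sub>3 - \<dots>\<close> of the sequence \<open>1, 2, \<dots>, m, \<mu>\<^sub>1, \<mu>\<^sub>2, \<dots>\<close>, whose
  sum is \<open>|\<lambda>|\<close>.

  Instead of manipulating conjugates, the proof strips the first column from \<open>\<lambda>\<close>, which corresponds
  to dropping a part \<open>m\<close> from \<open>\<mu>\<close> or, if \<open>\<mu>\<close> has none, to shortening the staircase. Both kinds of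
  objects therefore satisfy the same recurrence (\<open>strict_with_rank_Suc\<close>, \<open>staircase_tails_Suc\<close>), and
  \<open>card_strict_with_rank\<close> follows by induction.

  It remains to split the staircase. If \<open>a \<le> m\<close> is \<open>2 k - 1\<close> for \<open>k > 0\<close>, or \<open>- 2 k\<close> for \<open>k \<le> 0\<close>,
  then \<open>1, \<dots>, a\<close> has alternating sum \<open>k\<close> and sum \<open>k (2 k - 1)\<close>. So the rest
  \<open>a + 1, \<dots>, m, \<mu>\<^sub>1, \<mu>\<^sub>2, \<dots>\<close> has alternating sum zero: for \<open>a < m\<close> it is an \<open>(a, m - a)\<close>-sequence,
  and for \<open>a = m\<close> it is a partition with \<open>\<mu>\<^sub>1 = \<mu>\<^sub>2\<close>, \<open>\<mu>\<^sub>3 = \<mu>\<^sub>4\<close>, and so on.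
\<close>

section \<open>Alternating sums and staircases\<close>

fun altsum :: "nat list \<Rightarrow> int" where
  "altsum [] = 0"
| "altsum (x # xs) = int x - altsum xs"

lemma altsum_append: "altsum (xs @ ys) = altsum xs + (-1) ^ length xs * altsum ys"
  by (induction xs) auto

lemma altsum_eq_sum:
  "(\<Sum>i = 1..length ds. (-1) ^ i * int (ds ! (i - 1))) = - altsum ds"
proof (induction ds)
  case (Cons x ds)
  have "(\<Sum>i = 1..length (x # ds). (-1) ^ i * int ((x # ds) ! (i - 1)))
      = (\<Sum>i<Suc (length ds). (-1) ^ Suc i * int ((x # ds) ! i))"
    by (simp add: sum.atLeast1_atMost_eq)
  also have "\<dots> = - int x - (\<Sum>i<length ds. (-1) ^ Suc i * int (ds ! i))"
    by (simp add: sum.lessThan_Suc_shift sum_negf del: sum.lessThan_Suc)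
  also have "(\<Sum>i<length ds. (-1) ^ Suc i * int (ds ! i))
      = (\<Sum>i = 1..length ds. (-1) ^ i * int (ds ! (i - 1)))"
    by (simp add: sum.atLeast1_atMost_eq)
  finally show ?case using Cons.IH by simp
qed simp

definition staircase :: "nat \<Rightarrow> nat list" where
  "staircase m = [1..<Suc m]"

lemma staircase_0 [simp]: "staircase 0 = []"
  by (simp add: staircase_def)

lemma staircase_Suc: "staircase (Suc m) = staircase m @ [Suc m]"
  by (simp add: staircase_def)

lemma length_staircase [simp]: "length (staircase m) = m"
  by (simp add: staircase_def)

lemma staircase_add: "staircase (a + b) = staircase a @ [Suc a..<Suc (a + b)]"
  using upt_add_eq_append[of 1 "Suc a" b] by (simp add: staircase_def)

lemma sum_list_staircase: "2 * sum_list (staircase m) = m * (m + 1)"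
  by (induction m) (auto simp: staircase_Suc)

lemma altsum_staircase:
  "2 * altsum (staircase m) = of_bool (odd m) - (-1) ^ m * int m"
  by (induction m) (auto simp: staircase_Suc altsum_append algebra_simps)

section \<open>The BG-rank\<close>

lemma BG_rank_eq_sum:
  "BG_rank la = (\<Sum>i<length la. (-1) ^ i * of_bool (odd (la ! i)))"
proof -
  have split: "(-1) ^ i * of_bool P = of_bool (odd (Suc i) \<and> P) - (of_bool (even (Suc i) \<and> P) :: int)"
    for i P by auto
  have count: "int (card {i \<in> {1..n}. P i}) = (\<Sum>i<n. of_bool (P (Suc i)))" for P and n :: nat
  proof -
    have "int (card {i \<in> {1..n}. P i}) = (\<Sum>i = 1..n. of_bool (P i))"
      by (simp add: sum.If_cases of_bool_def Int_def)
    then show ?thesis by (simp add: sum.atLeast1_atMost_eq)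
  qed
  show ?thesis
    unfolding BG_rank_def count split sum_subtractf by simp
qed

lemma BG_rank_Nil [simp]: "BG_rank [] = 0"
  by (simp add: BG_rank_eq_sum)

lemma BG_rank_Cons [simp]: "BG_rank (x # xs) = of_bool (odd x) - BG_rank xs"
  by (simp add: BG_rank_eq_sum sum.lessThan_Suc_shift sum_negf del: sum.lessThan_Suc)

lemma BG_rank_append_0: "BG_rank (xs @ [0]) = BG_rank xs"
  by (induction xs) auto

text \<open>
  In the checkerboard colouring of the Young diagram the BG-rank is the sum of the colours
  \<open>\<plusminus>1\<close> of the cells. A new first column shifts the diagram, which reverses all colours, and
  itself contributes 1 or 0 according to the parity of its length.
\<close>

lemma BG_rank_map_Suc: "BG_rank (map Suc xs) = of_bool (odd (length xs)) - BG_rank xs"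
  by (induction xs) auto

section \<open>A common recurrence\<close>

definition strict_with_rank :: "nat \<Rightarrow> nat \<Rightarrow> int \<Rightarrow> nat list set" where
  "strict_with_rank m n k = {la. sorted_wrt (>) la \<and> (\<forall>p\<in>set la. 0 < p)
     \<and> length la = m \<and> sum_list la = n \<and> BG_rank la = k}"

definition staircase_tails :: "nat \<Rightarrow> nat \<Rightarrow> int \<Rightarrow> nat list set" where
  "staircase_tails m n k = {mu. sorted_wrt (\<ge>) mu \<and> set mu \<subseteq> {1..m}
     \<and> sum_list (staircase m @ mu) = n \<and> altsum (staircase m @ mu) = k}"

lemma strict_partitions_BG_eq:
  "strict_partitions_BG (int n) (int m) k = strict_with_rank m n k"
proof -
  have "is_partition la \<and> distinct la \<longleftrightarrow> sorted_wrt (>) la \<and> (\<forall>p\<in>set la. 0 < p)" for la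
    unfolding is_partition_def by (induction la) (auto simp: le_less)
  then show ?thesis
    by (auto simp: strict_partitions_BG_def strict_with_rank_def is_strict_partition_def)
qed

lemma finite_strict_with_rank: "finite (strict_with_rank m n k)"
  by (rule finite_subset[OF _ finite_positive_lists_sum[of n]]) (auto simp: strict_with_rank_def)

lemma finite_staircase_tails: "finite (staircase_tails m n k)"
proof (rule finite_subset)
  show "staircase_tails m n k \<subseteq> (\<Union>N\<le>n. {xs. (\<forall>x\<in>set xs. 0 < x) \<and> sum_list xs = N})"
    by (fastforce simp: staircase_tails_def)
  show "finite (\<Union>N\<le>n. {xs :: nat list. (\<forall>x\<in>set xs. 0 < x) \<and> sum_list xs = N})"
    using finite_positive_lists_sum by blast
qed

lemma sum_list_map_Suc: "sum_list (map Suc xs) = sum_list xs + length xs"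
  by (induction xs) auto

text \<open>
  Removing the first column of a strict partition with \<open>m + 1\<close> parts keeps the number of parts or,
  if the smallest part is 1, lowers it by one.
\<close>

lemma strict_with_rank_Suc:
  fixes m n :: nat and k :: int
  defines "k' \<equiv> of_bool (odd (Suc m)) - k"
  shows "strict_with_rank (Suc m) (n + Suc m) k =
    map Suc ` strict_with_rank (Suc m) n k' \<union>
    (\<lambda>la. map Suc (la @ [0])) ` strict_with_rank m n k'" (is "?L = ?A \<union> ?B")
proof
  show "?A \<union> ?B \<subseteq> ?L"
    by (auto simp: strict_with_rank_def k'_def sum_list_map_Suc BG_rank_map_Suc BG_rank_append_0
        sorted_wrt_map sorted_wrt_append simp flip: map_append)
  show "?L \<subseteq> ?A \<union> ?B"
  proof
    fix la assume la: "la \<in> ?L"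
    define l where "l = map (\<lambda>x. x - 1) la"
    have la_eq: "la = map Suc l"
      using la by (auto simp: l_def strict_with_rank_def intro: map_idI[symmetric])
    have l: "sorted_wrt (>) l" "length l = Suc m" "sum_list l = n" "BG_rank l = k'"
      using la by (auto simp: la_eq strict_with_rank_def sorted_wrt_map sum_list_map_Suc
          BG_rank_map_Suc k'_def)
    obtain l' x where l': "l = l' @ [x]"
      using l(2) by (cases l rule: rev_cases) auto
    show "la \<in> ?A \<union> ?B"
    proof (cases "x = 0")
      case True
      then have "l' \<in> strict_with_rank m n k'"
        using l by (auto simp: l' strict_with_rank_def sorted_wrt_append BG_rank_append_0)
      then show ?thesis using True la_eq l' by blast
    next
      case False
      then have "l \<in> strict_with_rank (Suc m) n k'"
        using l by (auto simp: l' strict_with_rank_def sorted_wrt_append)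
      then show ?thesis using la_eq by blast
    qed
  qed
qed

text \<open>
  A tail starting with \<open>m + 1\<close> loses that part; the same list, read after the shorter staircase,
  serves for all other tails. Either way an entry \<open>m + 1\<close> disappears from the sequence, so the
  entries behind it change sign and cancel in the sum of the old and the new alternating sum. What
  remains there, from the staircases and the lost entry, is 1 or 0 according to the parity of \<open>m + 1\<close>,
  just as for the BG-rank when a first column of length \<open>m + 1\<close> is removed.
\<close>

lemma staircase_tails_Suc:
  fixes m n :: nat and k :: int
  defines "k' \<equiv> of_bool (odd (Suc m)) - k"
  shows "staircase_tails (Suc m) (n + Suc m) k =
    Cons (Suc m) ` staircase_tails (Suc m) n k' \<union> staircase_tails m n k'" (is "?L = ?A \<union> ?B")
proof -
  have alt_Cons: "altsum (staircase (Suc m) @ Suc m # mu) = k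
      \<longleftrightarrow> altsum (staircase (Suc m) @ mu) = k'" for mu
    using altsum_staircase[of "Suc m"] by (auto simp: altsum_append k'_def algebra_simps)
  have alt_shorter: "altsum (staircase (Suc m) @ mu) = k \<longleftrightarrow> altsum (staircase m @ mu) = k'" for mu
    using altsum_staircase[of m]
    by (auto simp: staircase_Suc altsum_append k'_def algebra_simps)
  have sum_shorter: "sum_list (staircase (Suc m) @ mu) = n + Suc m
      \<longleftrightarrow> sum_list (staircase m @ mu) = n" for mu
    by (auto simp: staircase_Suc)
  show ?thesis
  proof
    show "?A \<union> ?B \<subseteq> ?L"
    proof
      fix mu assume "mu \<in> ?A \<union> ?B"
      then show "mu \<in> ?L"
      proof
        assume "mu \<in> ?A"
        then show ?thesis using alt_Cons by (auto simp: staircase_tails_def subset_iff)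
      next
        assume "mu \<in> ?B"
        then have "sorted_wrt (\<ge>) mu" "set mu \<subseteq> {1..m}" "sum_list (staircase m @ mu) = n"
          "altsum (staircase m @ mu) = k'"
          by (auto simp: staircase_tails_def)
        then show ?thesis
          using alt_shorter sum_shorter by (auto simp: staircase_tails_def)
      qed
    qed
    show "?L \<subseteq> ?A \<union> ?B"
    proof
      fix mu assume mu: "mu \<in> ?L"
      then have facts: "sorted_wrt (\<ge>) mu" "set mu \<subseteq> {1..Suc m}"
        "sum_list (staircase (Suc m) @ mu) = n + Suc m" "altsum (staircase (Suc m) @ mu) = k"
        by (auto simp: staircase_tails_def)
      show "mu \<in> ?A \<union> ?B"
      proof (cases "Suc m \<in> set mu")
        case True
        then obtain mu' where mu': "mu = Suc m # mu'"
          using facts(1,2) by (cases mu) (force dest: le_antisym)+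
        have "mu' \<in> staircase_tails (Suc m) n k'"
          using facts alt_Cons[of mu'] by (auto simp: staircase_tails_def mu')
        then show ?thesis by (simp add: mu')
      next
        case False
        have "set mu \<subseteq> {1..m}"
        proof
          fix x assume "x \<in> set mu"
          with False facts(2) have "x \<noteq> Suc m" "x \<in> {1..Suc m}" by auto
          then show "x \<in> {1..m}" by simp
        qed
        then show ?thesis
          using facts alt_shorter sum_shorter by (simp add: staircase_tails_def)
      qed
    qed
  qed
qed

lemma card_strict_with_rank: "card (strict_with_rank m n k) = card (staircase_tails m n k)"
proof (induction "m + n" arbitrary: m n k rule: less_induct)
  case less
  show ?case
  proof (cases m)
    case 0
    then have "strict_with_rank m n k = staircase_tails m n k"
      by (auto simp: strict_with_rank_def staircase_tails_def)
    then show ?thesis by simp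
  next
    case (Suc m')
    show ?thesis
    proof (cases "m \<le> n")
      case False
      have "m \<le> n" if "la \<in> strict_with_rank m n k" for la
      proof -
        have "length xs \<le> sum_list xs" if "\<forall>p\<in>set xs. 0 < p" for xs :: "nat list"
          using that by (induction xs) auto
        then show ?thesis using that by (auto simp: strict_with_rank_def)
      qed
      with False have "strict_with_rank m n k = {}" by auto
      moreover have "staircase_tails m n k = {}"
        using False by (auto simp: staircase_tails_def Suc staircase_Suc)
      ultimately show ?thesis by simp
    next
      case True
      then obtain n' where n: "n = n' + Suc m'"
        by (metis Suc add.commute le_Suc_ex)
      define k' where "k' = of_bool (odd (Suc m')) - k"
      \<comment> \<open>The two images are told apart by whether 1 is a part.\<close>
      have disjoint: "map Suc ` strict_with_rank (Suc m') n' k'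
          \<inter> (\<lambda>la. map Suc (la @ [0])) ` strict_with_rank m' n' k' = {}"
      proof -
        have "1 \<notin> set (map Suc la)" if "la \<in> strict_with_rank (Suc m') n' k'" for la
          using that by (auto simp: strict_with_rank_def)
        moreover have "1 \<in> set (map Suc (la @ [0]))" for la by simp
        ultimately show ?thesis by (metis (no_types, lifting) disjoint_iff imageE)
      qed
      have "card (strict_with_rank m n k)
          = card (strict_with_rank (Suc m') n' k') + card (strict_with_rank m' n' k')"
        unfolding Suc n strict_with_rank_Suc k'_def[symmetric]
        using disjoint
        by (subst card_Un_disjoint)
          (auto simp: finite_strict_with_rank card_image inj_on_def inj_map_eq_map)
      also have "\<dots> = card (staircase_tails (Suc m') n' k') + card (staircase_tails m' n' k')"
        using less.hyps by (simp add: Suc n)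
      also have "\<dots> = card (staircase_tails m n k)"
        unfolding Suc n staircase_tails_Suc k'_def[symmetric]
        by (subst card_Un_disjoint)
          (use finite_staircase_tails in \<open>auto simp: card_image\<close>,
            auto simp: staircase_tails_def)
      finally show ?thesis .
    qed
  qed
qed

section \<open>Splitting the staircase\<close>

text \<open>
  Both descriptions are of the sequences \<open>1, \<dots>, a + b, \<mu>\<^sub>1, \<mu>\<^sub>2, \<dots>\<close>; those of the left-hand side
  have been shortened by \<open>1, \<dots>, a\<close>.
\<close>

lemma ab_sequences_eq:
  assumes "0 < b"
  shows "{D \<in> ab_sequences a b. sum_list (staircase a) + sum_list D = n} =
    append [Suc a..<Suc (a + b)] ` staircase_tails (a + b) n (altsum (staircase a))"
    (is "?L = append ?r ` ?R")
proof -
  have tail_iff: "mu \<in> ?R \<longleftrightarrow> sorted_wrt (\<ge>) ((a + b) # mu) \<and> (\<forall>p\<in>set mu. 1 \<le> p)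
      \<and> sum_list (staircase a) + sum_list (?r @ mu) = n \<and> altsum (?r @ mu) = 0" for mu
  proof -
    have "sum_list (staircase (a + b) @ mu) = sum_list (staircase a) + sum_list (?r @ mu)"
      "altsum (staircase (a + b) @ mu) = altsum (staircase a) + (-1) ^ a * altsum (?r @ mu)"
      unfolding staircase_add by (simp_all add: altsum_append del: upt_Suc)
    then show ?thesis by (auto simp: staircase_tails_def simp del: upt_Suc)
  qed
  have decreasing_iff: "(\<forall>i\<in>{b..<length (?r @ mu)}. (?r @ mu) ! (i - 1) \<ge> (?r @ mu) ! i)
      \<longleftrightarrow> sorted_wrt (\<ge>) ((a + b) # mu)" for mu
  proof -
    have shift: "(?r @ mu) ! (b + j) = ((a + b) # mu) ! Suc j"
      "(?r @ mu) ! (b + j - 1) = ((a + b) # mu) ! j" for j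
      using assms by (auto simp: nth_append nth_Cons' simp del: upt_Suc)
    have "(\<forall>i\<in>{b..<length (?r @ mu)}. (?r @ mu) ! (i - 1) \<ge> (?r @ mu) ! i)
        \<longleftrightarrow> (\<forall>j<length mu. (?r @ mu) ! (b + j - 1) \<ge> (?r @ mu) ! (b + j))"
    proof -
      have "{b..<length (?r @ mu)} = (+) b ` {0..<length mu}"
        by (simp add: image_add_atLeastLessThan add.commute del: upt_Suc)
      then show ?thesis
        by (auto simp del: upt_Suc image_add_atLeastLessThan image_add_atLeastLessThan')
    qed
    also have "\<dots> \<longleftrightarrow> sorted_wrt (\<ge>) ((a + b) # mu)"
      unfolding shift by (subst sorted_wrt_iff_nth_Suc_transp) (auto simp: transp_def)
    finally show ?thesis .
  qed
  have positive_iff: "(\<forall>i\<in>{1..length ds}. 1 \<le> ds ! (i - 1)) \<longleftrightarrow> (\<forall>p\<in>set ds. 1 \<le> p)"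
    for ds :: "nat list"
  proof -
    have "{1..length ds} = Suc ` {..<length ds}"
      by (simp add: image_Suc_lessThan)
    then show ?thesis by (auto simp: all_set_conv_all_nth simp del: image_Suc_lessThan)
  qed
  have prefix_iff: "b \<le> length ds \<and> (\<forall>i\<in>{1..b}. ds ! (i - 1) = a + i)
      \<longleftrightarrow> (\<exists>mu. ds = ?r @ mu)" for ds
  proof
    assume *: "b \<le> length ds \<and> (\<forall>i\<in>{1..b}. ds ! (i - 1) = a + i)"
    have "take b ds = ?r"
    proof (rule nth_equalityI)
      fix i assume "i < length (take b ds)"
      then show "take b ds ! i = ?r ! i"
        using *[THEN conjunct2, rule_format, of "Suc i"] by (simp del: upt_Suc)
    qed (use * in \<open>simp del: upt_Suc\<close>)
    then show "\<exists>mu. ds = ?r @ mu" by (metis append_take_drop_id)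
  qed (auto simp: nth_append simp del: upt_Suc)
  have L_iff: "D \<in> ?L \<longleftrightarrow> (\<exists>mu. D = ?r @ mu) \<and> (\<forall>p\<in>set D. 1 \<le> p)
      \<and> (\<forall>i\<in>{b..<length D}. D ! (i - 1) \<ge> D ! i) \<and> altsum D = 0
      \<and> sum_list (staircase a) + sum_list D = n" for D
  proof -
    have "1 \<le> b" using assms by simp
    then show ?thesis
      unfolding ab_sequences_def altsum_eq_sum positive_iff prefix_iff[symmetric] mem_Collect_eq
        neg_equal_0_iff_equal
      by blast
  qed
  have append_iff: "?r @ mu \<in> ?L \<longleftrightarrow> mu \<in> ?R" for mu
  proof -
    have "(\<forall>p\<in>set (?r @ mu). 1 \<le> p) \<longleftrightarrow> (\<forall>p\<in>set mu. 1 \<le> p)"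
      by (auto simp del: upt_Suc)
    then show ?thesis unfolding L_iff tail_iff decreasing_iff by blast
  qed
  show ?thesis
  proof (intro set_eqI iffI)
    fix D assume D: "D \<in> ?L"
    then obtain mu where "D = ?r @ mu" unfolding L_iff by blast
    with D append_iff show "D \<in> append ?r ` ?R" by blast
  next
    fix D assume "D \<in> append ?r ` ?R"
    then show "D \<in> ?L" using append_iff by blast
  qed
qed

lemma card_ab_sequences:
  assumes "0 < b"
  shows "card {D \<in> ab_sequences a b. sum_list (staircase a) + sum_list D = n}
    = card (strict_with_rank (a + b) n (altsum (staircase a)))"
  unfolding ab_sequences_eq[OF assms] card_strict_with_rank
  by (rule card_image) (simp add: inj_on_def)

fun double_parts :: "nat list \<Rightarrow> nat list" where
  "double_parts [] = []"
| "double_parts (x # xs) = x # x # double_parts xs"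

lemma set_double_parts [simp]: "set (double_parts xs) = set xs"
  by (induction xs) auto

lemma sum_list_double_parts [simp]: "sum_list (double_parts xs) = 2 * sum_list xs"
  by (induction xs) auto

lemma altsum_double_parts [simp]: "altsum (double_parts xs) = 0"
  by (induction xs) auto

lemma sorted_double_parts [simp]:
  "sorted_wrt (\<ge>) (double_parts xs) \<longleftrightarrow> sorted_wrt (\<ge>) xs"
  by (induction xs) auto

lemma inj_double_parts: "inj double_parts"
proof (rule injI)
  show "double_parts xs = double_parts ys \<Longrightarrow> xs = ys" for xs ys
  proof (induction xs arbitrary: ys)
    case Nil
    then show ?case by (cases ys) auto
  next
    case (Cons x xs)
    then show ?case by (cases ys) auto
  qed
qed

lemma altsum_nonneg: "sorted_wrt (\<ge>) xs \<Longrightarrow> 0 \<le> altsum xs"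
  by (induction xs rule: induct_list012) auto

text \<open>
  The alternating sum of a partition is a sum of nonnegative differences
  \<open>\<mu>\<^sub>1 - \<mu>\<^sub>2\<close>, \<open>\<mu>\<^sub>3 - \<mu>\<^sub>4\<close>, \<dots>, so it vanishes only if all of these do.
\<close>

lemma altsum_zero_imp_double:
  assumes "sorted_wrt (\<ge>) mu" "\<forall>p\<in>set mu. 0 < p" "altsum mu = 0"
  shows "\<exists>la. mu = double_parts la"
  using assms
proof (induction mu rule: induct_list012)
  case 1
  then show ?case by (auto intro: exI[of _ "[]"])
next
  case (3 x y zs)
  have "0 \<le> altsum zs" using "3.prems" by (intro altsum_nonneg) auto
  then have "x = y" "altsum zs = 0" using "3.prems" by auto
  moreover obtain la where "zs = double_parts la"
    using "3.IH"(1) "3.prems" \<open>altsum zs = 0\<close> by auto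
  ultimately show ?case by (auto intro: exI[of _ "x # la"])
qed simp

lemma largest_part_le_iff: "largest_part la \<le> a \<longleftrightarrow> (\<forall>p\<in>set la. p \<le> a)"
  by (simp add: largest_part_def)

lemma card_double_partitions:
  "card {la. is_partition la \<and> largest_part la \<le> a
      \<and> sum_list (staircase a) + 2 * sum_list la = n}
    = card (strict_with_rank a n (altsum (staircase a)))" (is "card ?L = _")
proof -
  have "double_parts ` ?L = staircase_tails a n (altsum (staircase a))" (is "_ = ?R")
  proof
    show "double_parts ` ?L \<subseteq> ?R"
      by (auto simp: staircase_tails_def is_partition_def largest_part_le_iff altsum_append
          Suc_le_eq)
    show "?R \<subseteq> double_parts ` ?L"
    proof
      fix mu assume mu: "mu \<in> ?R"
      then have "sorted_wrt (\<ge>) mu" "\<forall>p\<in>set mu. 0 < p" "altsum mu = 0"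
        by (auto simp: staircase_tails_def altsum_append)
      then obtain la where "mu = double_parts la" using altsum_zero_imp_double by blast
      with mu show "mu \<in> double_parts ` ?L"
        by (auto simp: staircase_tails_def is_partition_def largest_part_le_iff altsum_append
            Suc_le_eq intro!: imageI)
    qed
  qed
  moreover have "card (double_parts ` ?L) = card ?L"
    by (rule card_image) (rule inj_on_subset[OF inj_double_parts subset_UNIV])
  ultimately show ?thesis
    unfolding card_strict_with_rank by simp
qed

section \<open>Strict partitions with given length and BG-rank\<close>

theorem theorem3p5:
  fixes k m n :: int
  assumes "k > 0 \<Longrightarrow> m \<ge> 2 * k - 1"
    and "k \<le> 0 \<Longrightarrow> m \<ge> - 2 * k"
    and "n \<ge> binom2 (m + 1)"
  shows
    "(k > 0 \<and> m > 2 * k - 1 \<longrightarrow>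
        card (strict_partitions_BG n m k) =
        card {D \<in> ab_sequences (nat (2 * k - 1)) (nat (m - 2 * k + 1)).
                int (sum_list D) = n - binom2 (2 * k)})
   \<and> (k > 0 \<and> m = 2 * k - 1 \<longrightarrow>
        card (strict_partitions_BG n m k) =
        card {la. is_partition la \<and> int (largest_part la) \<le> 2 * k - 1
                \<and> 2 * int (sum_list la) = n - binom2 (2 * k)})
   \<and> (k \<le> 0 \<and> m > - 2 * k \<longrightarrow>
        card (strict_partitions_BG n m k) =
        card {D \<in> ab_sequences (nat (- 2 * k)) (nat (m + 2 * k)).
                int (sum_list D) = n - binom2 (2 * k)})
   \<and> (k \<le> 0 \<and> m = - 2 * k \<longrightarrow>
        card (strict_partitions_BG n m k) =
        card {la. is_partition la \<and> int (largest_part la) \<le> - 2 * k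
                \<and> 2 * int (sum_list la) = n - binom2 (2 * k)})"
proof -
  \<comment> \<open>The initial staircase to be split off, in both sign cases of \<open>k\<close>.\<close>
  define a where "a = nat (if 0 < k then 2 * k - 1 else - 2 * k)"
  have a_pos: "int a = 2 * k - 1" if "0 < k" using that by (simp add: a_def)
  have a_neg: "int a = - 2 * k" if "k \<le> 0" using that by (simp add: a_def)
  have "int a \<le> m" using assms(1,2) a_pos a_neg by linarith
  then obtain M where M: "m = int M" by (metis nonneg_int_cases of_nat_0_le_iff order_trans)
  have "a \<le> M" using \<open>int a \<le> m\<close> M by simp
  have "0 \<le> binom2 (m + 1)" by (simp add: binom2_def M)
  then obtain N where N: "n = int N" using assms(3) by (metis nonneg_int_cases order_trans)
  have alt: "altsum (staircase a) = k"
  proof (cases "0 < k")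
    case True
    then have "odd a" using a_pos by presburger
    then show ?thesis using altsum_staircase[of a] a_pos[OF True] by simp
  next
    case False
    then have "even a" using a_neg by presburger
    then show ?thesis using altsum_staircase[of a] a_neg False by simp
  qed
  have sum: "int (sum_list (staircase a)) = binom2 (2 * k)"
  proof -
    have "2 * int (sum_list (staircase a)) = int a * (int a + 1)"
      using arg_cong[OF sum_list_staircase[of a], of int] by (simp add: algebra_simps)
    also have "\<dots> = 2 * (k * (2 * k - 1))"
    proof (cases "0 < k")
      case True
      then show ?thesis unfolding a_pos[OF True] by (simp add: algebra_simps)
    next
      case False
      then have "int a = - 2 * k" by (simp add: a_neg)
      then show ?thesis by (simp add: algebra_simps)
    qed
    finally show ?thesis by (simp add: binom2_double)
  qed
  have shift: "int s = n - binom2 (2 * k) \<longleftrightarrow> sum_list (staircase a) + s = N" for s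
    unfolding sum[symmetric] N by linarith
  have shift_double: "2 * int s = n - binom2 (2 * k) \<longleftrightarrow> sum_list (staircase a) + 2 * s = N" for s
    using shift[of "2 * s"] by simp
  have sequences: "card (strict_partitions_BG n m k)
      = card {D \<in> ab_sequences a (M - a). int (sum_list D) = n - binom2 (2 * k)}" if "a < M"
    unfolding shift using that card_ab_sequences[of "M - a" a N]
    by (simp add: M N strict_partitions_BG_eq alt)
  have partitions: "card (strict_partitions_BG n m k)
      = card {la. is_partition la \<and> largest_part la \<le> a
          \<and> 2 * int (sum_list la) = n - binom2 (2 * k)}" if "M = a"
    using that card_double_partitions[of a N] 
    unfolding shift_double by (simp add: M N strict_partitions_BG_eq alt)
  show ?thesis
  proof (cases "0 < k")
    case True
    have params: "nat (2 * k - 1) = a" "nat (m - 2 * k + 1) = M - a"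
      "2 * k - 1 < m \<longleftrightarrow> a < M" "m = 2 * k - 1 \<longleftrightarrow> M = a" "int s \<le> 2 * k - 1 \<longleftrightarrow> s \<le> a" for s
      using a_pos[OF True] \<open>a \<le> M\<close> M by linarith+
    have "\<not> k \<le> 0" using True by simp
    then show ?thesis unfolding params using sequences partitions by blast
  next
    case False
    then have a: "int a = - 2 * k" by (simp add: a_neg)
    have params: "nat (- 2 * k) = a" "nat (m + 2 * k) = M - a"
      "- 2 * k < m \<longleftrightarrow> a < M" "m = - 2 * k \<longleftrightarrow> M = a" "int s \<le> - 2 * k \<longleftrightarrow> s \<le> a" for s
      using a \<open>a \<le> M\<close> M by linarith+
    show ?thesis unfolding params using False sequences partitions by blast
  qed
qed

end
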